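(* Let $G=(V,E)$ be a locally finite random geometric graph with $V\subset\mathbb{R}$, whose law is invariant and ergodic under translations by $\mathbb{Z}$. Let $$\mathsf X=\sum_{x\in V:\,x\le 0}\ \sum_{y\in V:\,y>0}\mathbf 1\{\{x,y\}\in E\}$$ be the number of edges crossing the cut at $0+$. If $\mathbb{P}(\mathsf X<\infty)>0$, then almost surely every connected component of $G$ is recurrent.
   Context: A random geometric graph $G=(V,E)$ in $\mathbb{R}^d$ is a random graph with vertex set $V\subset\mathbb{R}^d$ and edge set $E$ consisting of unordered pairs of distinct elements of $V$. It is locally finite if, almost surely, $V\cap K$ is finite for every compact $K\subset\mathbb{R}^d$ and every vertex has finite graph degree. No independence of edges is assumed. Invariance and ergodicity under translations by $\mathbb{Z}$ (here $d=1$) mean that the law of $G$ is unchanged when all vertices (together with the edges between them) are shifted by an integer, and that every event invariant under these shifts has probability $0$ or $1$. Every graph is regarded as an electrical network with unit conductances. A connected component is recurrent if the effective resistance from one (equivalently every) vertex of that component to infinity is infinite (equivalently, simple random walk on it is recurrent); finite components are recurrent by convention. *)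

theory Defs
  imports "HOL-Probability.Probability"
begin

section \<open>Graphs and electrical networks\<close>

text \<open>A graph is a pair of a vertex set and a set of edges, the edges being two-element sets of
  vertices.\<close>

type_synonym 'a graph = "'a set \<times> 'a set set"

abbreviation verts :: "'a graph \<Rightarrow> 'a set" where
  "verts \<equiv> fst"

abbreviation edges :: "'a graph \<Rightarrow> 'a set set" where
  "edges \<equiv> snd"

definition graphs :: "'a graph set" where
  "graphs = {g. \<forall>e\<in>edges g. \<exists>x\<in>verts g. \<exists>y\<in>verts g. x \<noteq> y \<and> e = {x, y}}"

definition oriented_edges :: "'a graph \<Rightarrow> ('a \<times> 'a) set" where
  "oriented_edges g = {(x, y). {x, y} \<in> edges g}"

definition neighbours :: "'a graph \<Rightarrow> 'a \<Rightarrow> 'a set" where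
  "neighbours g x = {y. {x, y} \<in> edges g}"

definition component_of :: "'a graph \<Rightarrow> 'a \<Rightarrow> 'a set" where
  "component_of g x = {y. (x, y) \<in> (oriented_edges g)\<^sup>*}"

definition graph_components :: "'a graph \<Rightarrow> 'a set set" where
  "graph_components g = component_of g ` verts g"

text \<open>All conductances are 1, so harmonicity at \<open>x\<close> (Kirchhoff's node law) reads
  \<open>(\<Sum>y\<in>neighbours g x. h x - h y) = 0\<close>.  The unit voltage between \<open>a\<close> and the complement of
  \<open>K\<close> is uniquely determined if all degrees are finite, \<open>K\<close> is a finite subset of the component
  of \<open>a\<close>, and \<open>a \<in> K\<close>.\<close>

definition is_unit_voltage :: "'a graph \<Rightarrow> 'a \<Rightarrow> 'a set \<Rightarrow> ('a \<Rightarrow> real) \<Rightarrow> bool" where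
  "is_unit_voltage g a K h \<longleftrightarrow>
     h a = 1 \<and> (\<forall>x. x \<notin> K \<longrightarrow> h x = 0) \<and>
     (\<forall>x\<in>K - {a}. (\<Sum>y\<in>neighbours g x. h x - h y) = 0)"

definition unit_voltage :: "'a graph \<Rightarrow> 'a \<Rightarrow> 'a set \<Rightarrow> 'a \<Rightarrow> real" where
  "unit_voltage g a K = (THE h. is_unit_voltage g a K h)"

text \<open>Total current flowing out of \<open>a\<close> when \<open>a\<close> is kept at voltage 1 and everything outside
  \<open>K\<close> is grounded.\<close>

definition effective_conductance :: "'a graph \<Rightarrow> 'a \<Rightarrow> 'a set \<Rightarrow> real" where
  "effective_conductance g a K =
     (\<Sum>y\<in>neighbours g a. unit_voltage g a K a - unit_voltage g a K y)"

text \<open>In \<^typ>\<open>ereal\<close> we have \<open>1 / 0 = \<infinity>\<close>, as required for a zero conductance.\<close>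

definition effective_resistance :: "'a graph \<Rightarrow> 'a \<Rightarrow> 'a set \<Rightarrow> ereal" where
  "effective_resistance g a K = 1 / ereal (effective_conductance g a K)"

text \<open>The limit is taken as \<open>K\<close> exhausts the component of \<open>a\<close> by finite sets.\<close>

definition effective_resistance_to_infinity :: "'a graph \<Rightarrow> 'a \<Rightarrow> ereal" where
  "effective_resistance_to_infinity g a =
     Lim (finite_subsets_at_top (component_of g a)) (effective_resistance g a)"

definition recurrent_component :: "'a graph \<Rightarrow> 'a set \<Rightarrow> bool" where
  "recurrent_component g C \<longleftrightarrow>
     finite C \<or> (\<forall>a\<in>C. effective_resistance_to_infinity g a = \<infinity>)"


section \<open>Random geometric graphs\<close>

text \<open>The measurable structure on geometric graphs: the \<open>\<sigma>\<close>-algebra generated by the numbers of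
  vertices in Borel sets and of oriented edges in Borel sets of pairs.  (That one of these
  numbers is infinite is the complement of countably many generators.)\<close>

definition graph_space :: "'a::euclidean_space graph measure" where
  "graph_space = sigma graphs
     ({{g \<in> graphs. finite (verts g \<inter> A) \<and> card (verts g \<inter> A) = n} | A n. A \<in> sets borel} \<union>
      {{g \<in> graphs. finite (oriented_edges g \<inter> B) \<and> card (oriented_edges g \<inter> B) = n} | B n.
          B \<in> sets borel})"

definition random_geometric_graph :: "'w measure \<Rightarrow> ('w \<Rightarrow> 'a::euclidean_space graph) \<Rightarrow> bool" where
  "random_geometric_graph M G \<longleftrightarrow> prob_space M \<and> G \<in> measurable M graph_space"

definition law :: "'w measure \<Rightarrow> ('w \<Rightarrow> 'a::euclidean_space graph) \<Rightarrow> 'a graph measure" where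
  "law M G = distr M graph_space G"

definition locally_finite :: "'w measure \<Rightarrow> ('w \<Rightarrow> 'a::euclidean_space graph) \<Rightarrow> bool" where
  "locally_finite M G \<longleftrightarrow>
     (AE w in M. (\<forall>K. compact K \<longrightarrow> finite (verts (G w) \<inter> K)) \<and>
                 (\<forall>x\<in>verts (G w). finite (neighbours (G w) x)))"

definition translate :: "'a::euclidean_space \<Rightarrow> 'a graph \<Rightarrow> 'a graph" where
  "translate v g = ((\<lambda>x. x + v) ` verts g, (\<lambda>e. (\<lambda>x. x + v) ` e) ` edges g)"

definition translation_invariant ::
    "'a::euclidean_space set \<Rightarrow> 'w measure \<Rightarrow> ('w \<Rightarrow> 'a graph) \<Rightarrow> bool" where
  "translation_invariant T M G \<longleftrightarrow> (\<forall>v\<in>T. law M (\<lambda>w. translate v (G w)) = law M G)"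

definition translation_ergodic ::
    "'a::euclidean_space set \<Rightarrow> 'w measure \<Rightarrow> ('w \<Rightarrow> 'a graph) \<Rightarrow> bool" where
  "translation_ergodic T M G \<longleftrightarrow>
     (\<forall>A\<in>sets graph_space.
        (\<forall>v\<in>T. translate v -` A \<inter> space graph_space = A) \<longrightarrow> measure (law M G) A \<in> {0, 1})"

definition crossing_edges :: "real graph \<Rightarrow> ennreal" where
  "crossing_edges g =
     (\<Sum>\<^sub>\<infinity>x\<in>{x \<in> verts g. x \<le> 0}. \<Sum>\<^sub>\<infinity>y\<in>{y \<in> verts g. y > 0}. of_bool ({x, y} \<in> edges g))"

end

theory Submission
  imports Defs
begin

text \<open>Let \<open>X\<^sub>n\<close> be the number of edges crossing the cut at the integer \<open>n\<close>. Since
  \<open>X\<^sub>0\<close> is finite with positive probability, some \<open>N\<close> has \<open>P(X\<^sub>0 \<le> N) > 0\<close>. The events that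
  \<open>X\<^sub>n \<le> N\<close> for arbitrarily large positive, respectively negative, \<open>n\<close> are invariant, and by
  stationarity they have probability at least \<open>P(X\<^sub>0 \<le> N)\<close>; by ergodicity they are almost sure. Hence
  every component is exhausted by finite sets, cut out by intervals, with at most \<open>2N\<close> boundary
  edges. Averaging the indicators of \<open>m\<close> such sets with disjoint edge boundaries gives a test
  function of energy at most \<open>2N/m\<close>, so by Dirichlet's principle the effective conductance to
  infinity vanishes.\<close>

section \<open>Dirichlet forms on locally finite graphs\<close>

definition laplacian :: "'a graph \<Rightarrow> ('a \<Rightarrow> real) \<Rightarrow> 'a \<Rightarrow> real" where
  "laplacian g u x = (\<Sum>y\<in>neighbours g x. u x - u y)"

text \<open>Orientation out of \<open>W\<close> makes each boundary edge count exactly once.\<close>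

definition edge_boundary :: "'a graph \<Rightarrow> 'a set \<Rightarrow> ('a \<times> 'a) set" where
  "edge_boundary g W = oriented_edges g \<inter> W \<times> (- W)"

lemma neighbours_commute: "y \<in> neighbours g x \<longleftrightarrow> x \<in> neighbours g y"
  by (simp add: neighbours_def insert_commute)

lemma laplacian_add: "laplacian g (\<lambda>x. u x + v x) x = laplacian g u x + laplacian g v x"
  by (simp add: laplacian_def flip: sum.distrib) (simp add: algebra_simps)

lemma laplacian_diff: "laplacian g (\<lambda>x. u x - v x) x = laplacian g u x - laplacian g v x"
  by (simp add: laplacian_def flip: sum_subtractf) (simp add: algebra_simps)

lemma laplacian_mult: "laplacian g (\<lambda>x. c * u x) x = c * laplacian g u x"
  by (simp add: laplacian_def sum_distrib_left algebra_simps)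

text \<open>Summation by parts: the left side is a double sum over ordered pairs; adding it to
  itself with \<open>x\<close> and \<open>y\<close> exchanged and using symmetry of adjacency yields
  the product of differences. The factor 2 appears because each edge is met in both orientations.
  The set \<open>S\<close> keeps all sums finite.\<close>

lemma green_formula:
  fixes g :: "'a graph" and u v :: "'a \<Rightarrow> real"
  assumes fin: "finite K" "\<And>x. finite (neighbours g x)" and v0: "\<forall>x. x \<notin> K \<longrightarrow> v x = 0"
  defines "S \<equiv> K \<union> (\<Union>x\<in>K. neighbours g x)"
  shows "2 * (\<Sum>x\<in>K. v x * laplacian g u x) =
    (\<Sum>x\<in>S. \<Sum>y\<in>S. of_bool (y \<in> neighbours g x) * ((u x - u y) * (v x - v y)))"
proof -
  define c :: "'a \<Rightarrow> 'a \<Rightarrow> real" where "c x y = of_bool (y \<in> neighbours g x)" for x y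
  have c_sym: "c x y = c y x" for x y
    by (simp add: c_def neighbours_commute)
  have S: "finite S" "K \<subseteq> S"
    using fin by (auto simp: S_def)
  \<comment> \<open>Points of \<open>K\<close> have all their neighbours in \<open>S\<close>. For
    points of \<open>S - K\<close> this may fail, but there the factor \<open>v x\<close>
    vanishes.\<close>
  have lap: "laplacian g u x = (\<Sum>y\<in>S. c x y * (u x - u y))" if "x \<in> K" for x
  proof -
    have "(\<Sum>y\<in>S. c x y * (u x - u y)) = (\<Sum>y\<in>neighbours g x. c x y * (u x - u y))"
      using that S by (intro sum.mono_neutral_right) (auto simp: c_def S_def)
    also have "\<dots> = laplacian g u x"
      unfolding laplacian_def by (intro sum.cong refl) (simp add: c_def)
    finally show ?thesis ..
  qed
  have *: "(\<Sum>x\<in>K. v x * laplacian g u x) = (\<Sum>x\<in>S. \<Sum>y\<in>S. v x * (c x y * (u x - u y)))"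
  proof -
    have "(\<Sum>x\<in>K. v x * laplacian g u x) = (\<Sum>x\<in>K. \<Sum>y\<in>S. v x * (c x y * (u x - u y)))"
      by (simp add: lap sum_distrib_left)
    also have "\<dots> = (\<Sum>x\<in>S. \<Sum>y\<in>S. v x * (c x y * (u x - u y)))"
      using S v0 by (intro sum.mono_neutral_left) auto
    finally show ?thesis .
  qed
  also have "(\<Sum>x\<in>S. \<Sum>y\<in>S. v x * (c x y * (u x - u y))) =
      (\<Sum>x\<in>S. \<Sum>y\<in>S. v y * (c y x * (u y - u x)))"
    by (rule sum.swap)
  finally have "2 * (\<Sum>x\<in>K. v x * laplacian g u x) =
      (\<Sum>x\<in>S. \<Sum>y\<in>S. v x * (c x y * (u x - u y))) + (\<Sum>x\<in>S. \<Sum>y\<in>S. v y * (c y x * (u y - u x)))"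
    using * by simp
  also have "\<dots> = (\<Sum>x\<in>S. \<Sum>y\<in>S. c x y * ((u x - u y) * (v x - v y)))"
    unfolding sum.distrib[symmetric]
  proof (intro sum.cong refl)
    fix x y
    show "v x * (c x y * (u x - u y)) + v y * (c y x * (u y - u x)) = c x y * ((u x - u y) * (v x - v y))"
      unfolding c_sym[of y x] by algebra
  qed
  finally show ?thesis
    unfolding c_def .
qed

text \<open>The right side of Green's formula does not change when \<open>u\<close> and
  \<open>v\<close> are exchanged.\<close>

lemma laplacian_symmetric:
  assumes "finite K" "\<And>x. finite (neighbours g x)"
    and "\<forall>x. x \<notin> K \<longrightarrow> u x = 0" "\<forall>x. x \<notin> K \<longrightarrow> v x = 0"
  shows "(\<Sum>x\<in>K. v x * laplacian g u x) = (\<Sum>x\<in>K. u x * laplacian g v x)"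
  using green_formula[OF assms(1,2,4), of u] green_formula[OF assms(1,2,3), of v]
  by (simp add: mult.commute)

lemma dirichlet_form_nonneg:
  assumes "finite K" "\<And>x. finite (neighbours g x)" "\<forall>x. x \<notin> K \<longrightarrow> u x = 0"
  shows "(\<Sum>x\<in>K. u x * laplacian g u x) \<ge> 0"
proof -
  have "2 * (\<Sum>x\<in>K. u x * laplacian g u x) \<ge> 0"
    by (subst green_formula[OF assms]) (auto intro!: sum_nonneg)
  then show ?thesis by simp
qed

text \<open>Twice the form is a sum of squares of differences along edges, so each square vanishes.
  An edge with no end in \<open>K\<close> has \<open>u = 0\<close> at both ends.\<close>

lemma dirichlet_form_eq_0_imp_const_on_edges:
  assumes "finite K" "\<And>x. finite (neighbours g x)" "\<forall>x. x \<notin> K \<longrightarrow> u x = 0"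
    and 0: "(\<Sum>x\<in>K. u x * laplacian g u x) = 0" and e: "(x, y) \<in> oriented_edges g"
  shows "u x = u y"
proof (cases "x \<in> K \<or> y \<in> K")
  case True
  define S where "S = K \<union> (\<Union>x\<in>K. neighbours g x)"
  have y: "y \<in> neighbours g x" "x \<in> neighbours g y"
    using e by (auto simp: neighbours_def oriented_edges_def insert_commute)
  with True have S: "x \<in> S" "y \<in> S" "finite S"
    using assms(1,2) by (auto simp: S_def)
  have "(\<Sum>x\<in>S. \<Sum>y\<in>S. of_bool (y \<in> neighbours g x) * ((u x - u y) * (u x - u y))) = 0"
    using green_formula[OF assms(1-3), of u] 0 unfolding S_def by simp
  then have "\<forall>x\<in>S. (\<Sum>y\<in>S. of_bool (y \<in> neighbours g x) * ((u x - u y) * (u x - u y))) = 0"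
    by (subst (asm) sum_nonneg_eq_0_iff) (auto intro!: sum_nonneg S)
  then have "(\<Sum>y\<in>S. of_bool (y \<in> neighbours g x) * ((u x - u y) * (u x - u y))) = 0"
    using S by blast
  then have "\<forall>y\<in>S. of_bool (y \<in> neighbours g x) * ((u x - u y) * (u x - u y)) = 0"
    by (subst (asm) sum_nonneg_eq_0_iff) (auto intro!: S)
  then show ?thesis
    using S y by auto
qed (use assms(3) in auto)

lemma const_on_component:
  assumes "\<And>x y. (x, y) \<in> oriented_edges g \<Longrightarrow> u x = u y" and "x \<in> component_of g a"
  shows "u x = u a"
proof -
  have "(a, x) \<in> (oriented_edges g)\<^sup>*"
    using assms(2) by (simp add: component_of_def)
  then show ?thesis
    by induction (use assms(1) in auto)
qed


section \<open>Unit voltages\<close>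

text \<open>The voltage is the limit of the Jacobi iteration \<open>T\<close> started at 0, which is monotone and
  bounded by 1.\<close>

lemma ex_unit_voltage:
  assumes fin: "\<And>x. finite (neighbours g x)"
    and a: "a \<in> K"
  obtains h where "is_unit_voltage g a K h" "\<And>x. 0 \<le> h x" "\<And>x. h x \<le> 1"
proof -
  define T where "T h x = (if x = a then 1 else if x \<in> K
      then (\<Sum>y\<in>neighbours g x. h y) / card (neighbours g x) else 0)" for h :: "'a \<Rightarrow> real" and x
  define H where "H n = (T ^^ n) (\<lambda>_. 0)" for n
  have H0: "H 0 = (\<lambda>_. 0)" and HS: "H (Suc n) = T (H n)" for n
    by (simp_all add: H_def)
  have nonneg: "0 \<le> H n x" for n x
    by (induction n arbitrary: x) (auto simp: H0 HS T_def intro!: divide_nonneg_nonneg sum_nonneg)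
  have le1: "H n x \<le> 1" for n x
  proof (induction n arbitrary: x)
    case (Suc n)
    have "(\<Sum>y\<in>neighbours g x. H n y) \<le> card (neighbours g x)"
      using sum_bounded_above[of "neighbours g x" "H n" 1] Suc by simp
    then show ?case
      by (auto simp: HS T_def divide_le_eq_1)
  qed (simp add: H0)
  have mono: "H n x \<le> H (Suc n) x" for n x
  proof (induction n arbitrary: x)
    case 0
    show ?case using nonneg[of 1 x] by (simp add: H0)
  next
    case (Suc n)
    have "T (H n) x \<le> T (H (Suc n)) x"
      using Suc by (auto simp: T_def intro!: divide_right_mono sum_mono)
    then show ?case by (simp add: HS)
  qed
  have "\<exists>l. (\<lambda>n. H n x) \<longlonglongrightarrow> l" for x
    using incseq_convergent[of "\<lambda>n. H n x" 1] mono le1 by (metis incseq_SucI)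
  then obtain h where h: "\<And>x. (\<lambda>n. H n x) \<longlonglongrightarrow> h x"
    by metis
  \<comment> \<open>Degree 0 is a separate case because the average is then a division by zero, with
    value 0 at every stage.\<close>
  have "(\<lambda>n. T (H n) x) \<longlonglongrightarrow> T h x" for x
    unfolding T_def by (cases "card (neighbours g x) = 0") (auto intro!: tendsto_intros h)
  moreover have "(\<lambda>n. T (H n) x) \<longlonglongrightarrow> h x" for x
    using LIMSEQ_Suc[OF h[of x]] by (simp add: HS)
  ultimately have Th: "T h x = h x" for x
    using LIMSEQ_unique by blast
  have "is_unit_voltage g a K h"
    unfolding is_unit_voltage_def
  proof (intro conjI allI impI ballI)
    show "h a = 1"
      using Th[of a] by (simp add: T_def)
    show "h x = 0" if "x \<notin> K" for x
    proof -
      have "x \<noteq> a"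
        using that a by blast
      with that show ?thesis
        using Th[of x] by (simp add: T_def)
    qed
    fix x assume "x \<in> K - {a}"
    then have "(\<Sum>y\<in>neighbours g x. h y) / card (neighbours g x) = h x"
      using Th[of x] by (simp add: T_def)
    then have "(\<Sum>y\<in>neighbours g x. h y) = card (neighbours g x) * h x"
      using fin[of x] by (cases "neighbours g x = {}") (auto simp: field_simps)
    then show "(\<Sum>y\<in>neighbours g x. h x - h y) = 0"
      by (simp add: sum_subtractf)
  qed
  moreover have "0 \<le> h x" "h x \<le> 1" for x
    using LIMSEQ_le_const[OF h] LIMSEQ_le_const2[OF h] nonneg le1 by blast+
  ultimately show ?thesis
    using that by blast
qed

text \<open>Kirchhoff's law kills every term except the one at the source. Pairing any
  \<open>v\<close> with the voltage therefore only evaluates \<open>v\<close> at \<open>a\<close>,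
  which turns energies into currents.\<close>

lemma unit_voltage_pairing:
  assumes "is_unit_voltage g a K h" "finite K" "a \<in> K"
  shows "(\<Sum>x\<in>K. v x * laplacian g h x) = v a * laplacian g h a"
proof -
  have "(\<Sum>x\<in>K. v x * laplacian g h x) = (\<Sum>x\<in>{a}. v x * laplacian g h x)"
    using assms by (intro sum.mono_neutral_right) (auto simp: is_unit_voltage_def laplacian_def)
  then show ?thesis by simp
qed

text \<open>The difference \<open>d\<close> of two voltages has \<open>d a = 0\<close>, so by the
  pairing its energy is zero and it is constant on the component of \<open>a\<close>. Since
  \<open>K\<close> lies in that component, \<open>d\<close> vanishes on \<open>K\<close>; a further
  finite component inside \<open>K\<close> could carry any constant voltage.\<close>

lemma unit_voltage_unique:
  assumes fin: "\<And>x. finite (neighbours g x)" "finite K" and K: "a \<in> K" "K \<subseteq> component_of g a"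
    and h: "is_unit_voltage g a K h" and h': "is_unit_voltage g a K h'"
  shows "h = h'"
proof
  fix x
  define d where "d x = h x - h' x" for x
  have off: "\<forall>x. x \<notin> K \<longrightarrow> d x = 0"
    using h h' by (simp add: d_def is_unit_voltage_def)
  have "d a = 0"
    using h h' by (simp add: d_def is_unit_voltage_def)
  then have "(\<Sum>x\<in>K. d x * laplacian g d x) = 0"
    using unit_voltage_pairing[OF h fin(2) K(1), of d] unit_voltage_pairing[OF h' fin(2) K(1), of d]
    unfolding d_def laplacian_diff by (simp add: right_diff_distrib sum_subtractf)
  then have "d x = 0" if "x \<in> K" for x
    using const_on_component[of g d x a] dirichlet_form_eq_0_imp_const_on_edges[of K g d] off fin
      that K \<open>d a = 0\<close> by (metis subset_iff)
  then show "h x = h' x"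
    using off by (cases "x \<in> K") (auto simp: d_def)
qed

lemma unit_voltage:
  assumes "\<And>x. finite (neighbours g x)" "finite K" "a \<in> K" "K \<subseteq> component_of g a"
  shows "is_unit_voltage g a K (unit_voltage g a K)"
    and "0 \<le> unit_voltage g a K x" "unit_voltage g a K x \<le> 1"
proof -
  obtain h where h: "is_unit_voltage g a K h" "\<And>x. 0 \<le> h x" "\<And>x. h x \<le> 1"
    using ex_unit_voltage[OF assms(1,3)] by blast
  then have "unit_voltage g a K = h"
    unfolding unit_voltage_def using unit_voltage_unique[OF assms] by blast
  then show "is_unit_voltage g a K (unit_voltage g a K)"
    and "0 \<le> unit_voltage g a K x" "unit_voltage g a K x \<le> 1"
    using h by auto
qed

lemma effective_conductance_eq_laplacian:
  "effective_conductance g a K = laplacian g (unit_voltage g a K) a"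
  by (simp add: effective_conductance_def laplacian_def)

lemma effective_conductance_nonneg:
  assumes "\<And>x. finite (neighbours g x)" "finite K" "a \<in> K" "K \<subseteq> component_of g a"
  shows "effective_conductance g a K \<ge> 0"
  using unit_voltage[OF assms] unfolding effective_conductance_def is_unit_voltage_def
  by (auto intro!: sum_nonneg)

text \<open>Among functions vanishing off \<open>K\<close> with value \<open>f a\<close> at
  \<open>a\<close>, the multiple \<open>f a * h\<close> of the voltage has least energy. Indeed the
  energy of \<open>d = f a * h - f\<close> is nonnegative, and because \<open>d a = 0\<close> it
  expands to the energy of \<open>f\<close> minus that of \<open>f a * h\<close>.\<close>

lemma dirichlet_principle:
  assumes fin: "\<And>x. finite (neighbours g x)" "finite K" and K: "a \<in> K" "K \<subseteq> component_of g a"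
    and f0: "\<forall>x. x \<notin> K \<longrightarrow> f x = 0"
  shows "(f a)\<^sup>2 * effective_conductance g a K \<le> (\<Sum>x\<in>K. f x * laplacian g f x)"
proof -
  define h where "h = unit_voltage g a K"
  define I where "I = effective_conductance g a K"
  note h = unit_voltage(1)[OF fin K, folded h_def]
  have h0: "\<forall>x. x \<notin> K \<longrightarrow> h x = 0"
    using h by (simp add: is_unit_voltage_def)
  have ha: "h a = 1"
    using h by (simp add: is_unit_voltage_def)
  have pair: "(\<Sum>x\<in>K. v x * laplacian g h x) = v a * I" for v
    using unit_voltage_pairing[OF h fin(2) K(1)]
    by (simp add: I_def effective_conductance_eq_laplacian h_def)
  define d where "d x = f a * h x - f x" for x
  have lap: "laplacian g d x = f a * laplacian g h x - laplacian g f x" for x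
    by (simp add: d_def[abs_def] laplacian_diff laplacian_mult)
  have "0 \<le> (\<Sum>x\<in>K. d x * laplacian g d x)"
    by (rule dirichlet_form_nonneg[OF fin(2,1)]) (simp add: d_def h0 f0)
  also have "\<dots> = (\<Sum>x\<in>K. f a * (d x * laplacian g h x)) - (\<Sum>x\<in>K. d x * laplacian g f x)"
    by (simp add: lap algebra_simps flip: sum_subtractf)
  also have "(\<Sum>x\<in>K. f a * (d x * laplacian g h x)) = f a * (d a * I)"
    by (simp add: pair flip: sum_distrib_left)
  also have "(\<Sum>x\<in>K. d x * laplacian g f x) =
      f a * (\<Sum>x\<in>K. h x * laplacian g f x) - (\<Sum>x\<in>K. f x * laplacian g f x)"
    by (simp add: d_def sum_distrib_left flip: sum_subtractf) (simp add: algebra_simps)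
  also have "(\<Sum>x\<in>K. h x * laplacian g f x) = f a * I"
    using laplacian_symmetric[OF fin(2,1), of f h] by (simp add: f0 h0 pair)
  finally show ?thesis
    by (simp add: d_def ha I_def power2_eq_square)
qed


section \<open>A Nash-Williams criterion\<close>

text \<open>Only points of \<open>W\<close> contribute, and at such a point the Laplacian of the
  indicator counts the neighbours outside \<open>W\<close>.\<close>

lemma dirichlet_form_indicator:
  assumes fin: "\<And>x. finite (neighbours g x)" and W: "finite W" "W \<subseteq> K" "finite K"
  shows "(\<Sum>x\<in>K. indicator W x * laplacian g (indicator W) x) = card (edge_boundary g W)"
proof -
  have "(\<Sum>x\<in>K. indicator W x * laplacian g (indicator W) x) = (\<Sum>x\<in>W. laplacian g (indicator W) x)"
    using W by (intro sum.mono_neutral_cong_right) (auto simp: indicator_def)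
  also have "\<dots> = (\<Sum>x\<in>W. \<Sum>y\<in>neighbours g x - W. 1)"
    unfolding laplacian_def
    using fin by (intro sum.cong refl sum.mono_neutral_cong_right) (auto simp: indicator_def)
  also have "\<dots> = card (SIGMA x:W. neighbours g x - W)"
    using W fin by (subst card_SigmaI) auto
  also have "(SIGMA x:W. neighbours g x - W) = edge_boundary g W"
    by (auto simp: edge_boundary_def oriented_edges_def neighbours_def)
  finally show ?thesis .
qed

text \<open>The test function is a sum of indicators of nested sets. If each set contains the previous
  one together with its neighbours, the edge boundaries are disjoint, so the mixed terms of the
  Dirichlet form vanish.\<close>

lemma ex_test_function:
  fixes N :: nat
  assumes fin: "\<And>x. finite (neighbours g x)" and C: "C = component_of g a"
    and ex: "\<forall>F. finite F \<longrightarrow> F \<subseteq> C \<longrightarrow> (\<exists>W. finite W \<and> F \<subseteq> W \<and> W \<subseteq> C \<and> card (edge_boundary g W) \<le> N)"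
  shows "\<exists>f F. finite F \<and> F \<subseteq> C \<and> a \<in> F \<and> (\<forall>x. x \<notin> F \<longrightarrow> f x = 0) \<and> f a = real m \<and>
    (\<forall>K. finite K \<longrightarrow> F \<subseteq> K \<longrightarrow> (\<Sum>x\<in>K. f x * laplacian g f x) \<le> real m * real N)"
proof (induction m)
  case 0
  show ?case
    by (rule exI[of _ "\<lambda>_. 0"], rule exI[of _ "{a}"]) (simp add: C component_of_def)
next
  case (Suc m)
  then obtain f F where F: "finite F" "F \<subseteq> C" "a \<in> F" and f0: "\<And>x. x \<notin> F \<Longrightarrow> f x = 0"
    and fa: "f a = real m"
    and E: "\<And>K. finite K \<Longrightarrow> F \<subseteq> K \<Longrightarrow> (\<Sum>x\<in>K. f x * laplacian g f x) \<le> real m * real N"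
    by blast
  define F' where "F' = F \<union> (\<Union>x\<in>F. neighbours g x)"
  have "neighbours g x \<subseteq> C" if "x \<in> C" for x
    using that by (auto simp: C component_of_def neighbours_def oriented_edges_def
        intro: rtrancl_into_rtrancl)
  then have "finite F'" "F' \<subseteq> C"
    using F fin by (auto simp: F'_def)
  then obtain W where W: "finite W" "F' \<subseteq> W" "W \<subseteq> C" "card (edge_boundary g W) \<le> N"
    using ex[rule_format, of F'] by blast
  then have FW: "F \<subseteq> W"
    by (auto simp: F'_def)
  define i :: "'a \<Rightarrow> real" where "i = indicator W"
  define f' where "f' x = f x + i x" for x
  have "(\<Sum>x\<in>K. f' x * laplacian g f' x) \<le> real (Suc m) * real N" if K: "finite K" "W \<subseteq> K" for K
  proof -
    have "laplacian g i x = 0" if "x \<in> F" for x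
      unfolding laplacian_def using that W(2) by (intro sum.neutral) (auto simp: i_def F'_def indicator_def)
    then have mixed: "(\<Sum>x\<in>K. f x * laplacian g i x) = 0"
      using f0 by (intro sum.neutral) (metis mult_eq_0_iff)
    \<comment> \<open>The other mixed term need not vanish term by term; symmetry of the form
      carries the vanishing over to it.\<close>
    moreover have "(\<Sum>x\<in>K. f x * laplacian g i x) = (\<Sum>x\<in>K. i x * laplacian g f x)"
      using K FW by (intro laplacian_symmetric fin) (auto simp: i_def indicator_def intro: f0)
    moreover have "(\<Sum>x\<in>K. i x * laplacian g i x) \<le> N"
      using dirichlet_form_indicator[OF fin W(1) K(2,1)] W(4) by (simp add: i_def)
    moreover have "(\<Sum>x\<in>K. f x * laplacian g f x) \<le> real m * real N"
      using E K FW by blast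
    moreover have "(\<Sum>x\<in>K. f' x * laplacian g f' x) =
        (\<Sum>x\<in>K. f x * laplacian g f x) + (\<Sum>x\<in>K. f x * laplacian g i x) +
        (\<Sum>x\<in>K. i x * laplacian g f x) + (\<Sum>x\<in>K. i x * laplacian g i x)"
      by (simp add: f'_def[abs_def] laplacian_add algebra_simps flip: sum.distrib)
    ultimately show ?thesis
      by (simp add: algebra_simps)
  qed
  moreover have "f' a = real (Suc m)" "\<And>x. x \<notin> W \<Longrightarrow> f' x = 0" "a \<in> W"
    using F(3) FW f0 fa by (auto simp: f'_def i_def)
  ultimately show ?case
    using W by blast
qed

text \<open>A test function with value \<open>m\<close> at \<open>a\<close> and energy at most
  \<open>m * N\<close> gives, by Dirichlet's principle, a conductance of at most
  \<open>N / m\<close> for every finite \<open>K\<close> containing its support set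
  \<open>F\<close>.\<close>

lemma effective_conductance_tendsto_0:
  fixes N :: nat
  assumes fin: "\<And>x. finite (neighbours g x)" and C: "C = component_of g a"
    and ex: "\<forall>F. finite F \<longrightarrow> F \<subseteq> C \<longrightarrow> (\<exists>W. finite W \<and> F \<subseteq> W \<and> W \<subseteq> C \<and> card (edge_boundary g W) \<le> N)"
    and "e > 0"
  shows "\<forall>\<^sub>F K in finite_subsets_at_top C.
    0 \<le> effective_conductance g a K \<and> effective_conductance g a K < e"
proof -
  \<comment> \<open>The choice makes \<open>N / m < e\<close>; the maximum with 0 also delivers
    \<open>m > 0\<close>, used to cancel a factor \<open>m\<close>.\<close>
  obtain m :: nat where m: "real N / e < real m" "m > 0"
    using reals_Archimedean2[of "max 0 (real N / e)"] by auto
  obtain f F where F: "finite F" "F \<subseteq> C" "a \<in> F" and f0: "\<And>x. x \<notin> F \<Longrightarrow> f x = 0"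
    and fa: "f a = real m"
    and E: "\<And>K. finite K \<Longrightarrow> F \<subseteq> K \<Longrightarrow> (\<Sum>x\<in>K. f x * laplacian g f x) \<le> real m * real N"
    using ex_test_function[OF fin C ex, where m = m] by blast
  have "0 \<le> effective_conductance g a K \<and> effective_conductance g a K < e"
    if K: "finite K" "F \<subseteq> K" "K \<subseteq> C" for K
  proof
    have K': "a \<in> K" "K \<subseteq> component_of g a"
      using K F C by auto
    show "0 \<le> effective_conductance g a K"
      by (rule effective_conductance_nonneg[OF fin K(1) K'])
    have "(f a)\<^sup>2 * effective_conductance g a K \<le> (\<Sum>x\<in>K. f x * laplacian g f x)"
      using K f0 by (intro dirichlet_principle[OF fin K(1) K']) auto
    also have "\<dots> \<le> real m * real N"
      using E K by blast
    finally have "real m * effective_conductance g a K \<le> real N"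
      using m(2) by (simp add: fa power2_eq_square mult.assoc)
    also have "\<dots> < real m * e"
      using m \<open>e > 0\<close> by (simp add: field_simps)
    finally show "effective_conductance g a K < e"
      using m(2) by simp
  qed
  then show ?thesis
    unfolding eventually_finite_subsets_at_top using F by blast
qed

text \<open>Conductances that are nonnegative and tend to 0 have reciprocals tending to infinity, a
  zero conductance having reciprocal infinity in \<open>ereal\<close>. The filter of finite subsets
  is nontrivial, so \<open>Lim\<close> picks out this limit.\<close>

theorem nash_williams_bounded_boundaries:
  fixes N :: nat
  assumes "\<And>x. finite (neighbours g x)" and "C = component_of g a"
    and "\<forall>F. finite F \<longrightarrow> F \<subseteq> C \<longrightarrow> (\<exists>W. finite W \<and> F \<subseteq> W \<and> W \<subseteq> C \<and> card (edge_boundary g W) \<le> N)"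
  shows "effective_resistance_to_infinity g a = \<infinity>"
proof -
  have "(effective_resistance g a \<longlongrightarrow> \<infinity>) (finite_subsets_at_top C)"
    unfolding tendsto_PInfty
  proof
    fix r :: real
    \<comment> \<open>The absolute value covers negative \<open>r\<close>, and the added 1 keeps the
      denominator positive.\<close>
    define e where "e = 1 / (\<bar>r\<bar> + 1)"
    have "e > 0" by (simp add: e_def)
    from effective_conductance_tendsto_0[OF assms this]
    show "\<forall>\<^sub>F K in finite_subsets_at_top C. ereal r < effective_resistance g a K"
    proof eventually_elim
      case (elim K)
      define c where "c = effective_conductance g a K"
      show ?case
      proof (cases "c = 0")
        case True
        then show ?thesis
          by (simp add: effective_resistance_def divide_ereal_def flip: c_def zero_ereal_def)
      next
        case False
        with elim have c: "0 < c" "c < e"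
          by (auto simp: c_def)
        then have "c * (\<bar>r\<bar> + 1) < 1"
          by (simp add: e_def field_simps)
        then have "c * r < 1"
          using c mult_left_mono[of r "\<bar>r\<bar> + 1" c] by linarith
        then have "r < 1 / c"
          using c by (simp add: field_simps)
        moreover have "effective_resistance g a K = ereal (1 / c)"
          using False by (simp add: effective_resistance_def one_ereal_def flip: c_def)
        ultimately show ?thesis by simp
      qed
    qed
  qed
  then show ?thesis
    unfolding effective_resistance_to_infinity_def
    using tendsto_Lim[OF finite_subsets_at_top_neq_bot] assms(2) by blast
qed


section \<open>Cuts of graphs on the real line\<close>

text \<open>Orientation from left to right counts each crossing edge once. At \<open>t = 0\<close> a
  vertex at 0 belongs to the left side, as in \<open>crossing_edges\<close>.\<close>

definition cut_edges :: "real \<Rightarrow> real graph \<Rightarrow> (real \<times> real) set" where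
  "cut_edges t g = oriented_edges g \<inter> {..t} \<times> {t<..}"

text \<open>Finiteness is stated explicitly because \<open>card\<close> of an infinite set is
  0.\<close>

definition small_cut :: "nat \<Rightarrow> real \<Rightarrow> real graph set" where
  "small_cut N t = {g \<in> graphs. finite (cut_edges t g) \<and> card (cut_edges t g) \<le> N}"

lemma edge_endpoints_in_verts:
  assumes "g \<in> graphs" "{x, y} \<in> edges g"
  shows "x \<in> verts g" "y \<in> verts g"
proof -
  obtain u v where "u \<in> verts g" "v \<in> verts g" "{x, y} = {u, v}"
    using assms unfolding graphs_def by blast
  then show "x \<in> verts g" "y \<in> verts g"
    by (auto simp: doubleton_eq_iff)
qed

lemma component_of_subset_verts:
  assumes "g \<in> graphs" "a \<in> verts g"
  shows "component_of g a \<subseteq> verts g"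
proof
  fix x assume "x \<in> component_of g a"
  then have "(a, x) \<in> (oriented_edges g)\<^sup>*"
    by (simp add: component_of_def)
  then show "x \<in> verts g"
  proof induction
    case (step y z)
    then show ?case
      using edge_endpoints_in_verts(2)[OF assms(1)] by (simp add: oriented_edges_def)
  qed (rule assms(2))
qed

lemma component_of_eq:
  assumes "b \<in> component_of g a"
  shows "component_of g b = component_of g a"
proof -
  have "sym ((oriented_edges g)\<^sup>*)"
    by (intro sym_rtrancl symI) (simp add: oriented_edges_def insert_commute)
  then show ?thesis
    using assms unfolding component_of_def by (auto dest: symD intro: rtrancl_trans)
qed

text \<open>The deterministic core: a window \<open>(-p, q]\<close> between two small cuts meets
  \<open>C\<close> in a finite set. An edge leaving that set stays in \<open>C\<close>, so it must
  leave the window and cross one of the two cuts.\<close>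

lemma recurrent_component_if_small_cuts:
  fixes g :: "real graph"
  assumes g: "g \<in> graphs" and fin: "\<And>K. compact K \<Longrightarrow> finite (verts g \<inter> K)"
    and deg: "\<And>x. x \<in> verts g \<Longrightarrow> finite (neighbours g x)"
    and right: "\<And>k::int. \<exists>n\<ge>k. g \<in> small_cut N (of_int n)"
    and left: "\<And>k::int. \<exists>n\<ge>k. g \<in> small_cut N (of_int (- n))"
    and C: "C \<in> graph_components g"
  shows "recurrent_component g C"
proof -
  \<comment> \<open>The network criterion asks for finite degree at every real number; points that
    are not vertices have no neighbours.\<close>
  have nb: "finite (neighbours g x)" for x
  proof (cases "x \<in> verts g")
    case False
    then have "neighbours g x = {}"
      using edge_endpoints_in_verts[OF g] by (auto simp: neighbours_def)
    then show ?thesis by simp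
  qed (rule deg)
  \<comment> \<open>Infinite resistance is proved for finite and infinite components alike.\<close>
  have "effective_resistance_to_infinity g b = \<infinity>" if b: "b \<in> C" for b
  proof (rule nash_williams_bounded_boundaries[where N = "N + N" and C = C, OF nb])
    show Cb: "C = component_of g b"
      using C b component_of_eq[of b g] by (auto simp: graph_components_def)
    have CV: "C \<subseteq> verts g"
      using C component_of_subset_verts[OF g] by (auto simp: graph_components_def)
    show "\<forall>F. finite F \<longrightarrow> F \<subseteq> C \<longrightarrow>
        (\<exists>W. finite W \<and> F \<subseteq> W \<and> W \<subseteq> C \<and> card (edge_boundary g W) \<le> N + N)"
    proof (intro allI impI)
      fix F assume F: "finite F" "F \<subseteq> C"
      obtain B where B: "\<And>x. x \<in> F \<Longrightarrow> \<bar>x\<bar> \<le> B"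
        using finite_imp_bounded[OF F(1)] by (auto simp: bounded_iff)
      obtain q where q: "q \<ge> \<lceil>B\<rceil> + 1" "g \<in> small_cut N (of_int q)"
        using right by blast
      \<comment> \<open>The added 1 yields the strict bound \<open>B < p\<close>, since the window
        is open on the left.\<close>
      obtain p where p: "p \<ge> \<lceil>B\<rceil> + 1" "g \<in> small_cut N (of_int (- p))"
        using left by blast
      define W where "W = C \<inter> {of_int (- p)<..of_int q}"
      have "finite W"
        by (rule finite_subset[OF _ fin[of "{of_int (- p)..of_int q}"]]) (use CV in \<open>auto simp: W_def\<close>)
      moreover have "F \<subseteq> W"
      proof
        fix x assume x: "x \<in> F"
        have "B \<le> of_int q" "B < of_int p"
          using p(1) q(1) by linarith+
        then show "x \<in> W"
          using B[OF x] x F by (auto simp: W_def)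
      qed
      moreover have "card (edge_boundary g W) \<le> N + N"
      proof -
        let ?Q = "cut_edges (of_int q) g" and ?P = "cut_edges (of_int (- p)) g"
        have closed: "y \<in> C" if "x \<in> C" "(x, y) \<in> oriented_edges g" for x y
          using that Cb by (auto simp: component_of_def)
        \<comment> \<open>A boundary edge leaving through the left end points from right to left, so
          it is the swap of a pair in \<open>?P\<close>.\<close>
        have "edge_boundary g W \<subseteq> ?Q \<union> prod.swap ` ?P"
        proof
          fix e assume e: "e \<in> edge_boundary g W"
          then obtain x y where xy: "e = (x, y)" "(x, y) \<in> oriented_edges g" "x \<in> W" "y \<notin> W"
            by (auto simp: edge_boundary_def)
          then have "y \<le> of_int (- p) \<or> y > of_int q"
            using closed by (auto simp: W_def)
          moreover have "(y, x) \<in> oriented_edges g"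
            using xy by (simp add: oriented_edges_def insert_commute)
          ultimately show "e \<in> ?Q \<union> prod.swap ` ?P"
            using xy by (force simp: cut_edges_def W_def)
        qed
        moreover have "finite ?Q" "card ?Q \<le> N" "finite ?P" "card ?P \<le> N"
          using p q by (auto simp: small_cut_def)
        moreover have "card (prod.swap ` ?P) = card ?P"
          by (intro card_image) auto
        ultimately show ?thesis
          using card_mono[of "?Q \<union> prod.swap ` ?P" "edge_boundary g W"]
            card_Un_le[of ?Q "prod.swap ` ?P"] by simp
      qed
      ultimately show "\<exists>W. finite W \<and> F \<subseteq> W \<and> W \<subseteq> C \<and> card (edge_boundary g W) \<le> N + N"
        by (intro exI[of _ W]) (auto simp: W_def)
    qed
  qed
  then show ?thesis
    by (simp add: recurrent_component_def)
qed

text \<open>Infinitely many terms of size at least 1 would give finite partial sums above every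
  natural number.\<close>

lemma finite_if_infsum_ennreal_finite:
  fixes f :: "'a \<Rightarrow> ennreal"
  assumes "(\<Sum>\<^sub>\<infinity>x\<in>A. f x) < \<infinity>"
  shows "finite {x \<in> A. f x \<ge> 1}"
proof (rule ccontr)
  let ?B = "{x \<in> A. f x \<ge> 1}"
  assume "\<not> finite ?B"
  have le: "of_nat n \<le> (\<Sum>\<^sub>\<infinity>x\<in>A. f x)" for n
  proof -
    obtain F where F: "F \<subseteq> ?B" "finite F" "card F = n"
      using infinite_arbitrarily_large[OF \<open>\<not> finite ?B\<close>] by blast
    have "of_nat n = (\<Sum>x\<in>F. 1 :: ennreal)"
      using F by simp
    also have "\<dots> \<le> (\<Sum>x\<in>F. f x)"
      using F by (intro sum_mono) auto
    also have "\<dots> = (\<Sum>\<^sub>\<infinity>x\<in>F. f x)"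
      using F by simp
    also have "\<dots> \<le> (\<Sum>\<^sub>\<infinity>x\<in>A. f x)"
      using F by (intro infsum_mono_neutral nonneg_summable_on_complete) auto
    finally show ?thesis .
  qed
  show False
    using ennreal_Ex_less_of_nat[of "\<Sum>\<^sub>\<infinity>x\<in>A. f x"] assms le by (metis infinity_ennreal_def leD)
qed

text \<open>Each inner sum is at most the total, so each left vertex has finitely many crossing
  edges. A left vertex with a crossing edge contributes at least 1, so there are finitely many of
  these vertices.\<close>

lemma finite_cut_edges_if_crossing_edges_finite:
  assumes g: "g \<in> graphs" and "crossing_edges g < \<infinity>"
  shows "finite (cut_edges 0 g)"
proof -
  define X Y where "X = {x \<in> verts g. x \<le> 0}" and "Y = {y \<in> verts g. y > 0}"
  define c where "c x = (\<Sum>\<^sub>\<infinity>y\<in>Y. of_bool ({x, y} \<in> edges g) :: ennreal)" for x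
  have fin: "(\<Sum>\<^sub>\<infinity>x\<in>X. c x) < \<infinity>"
    using assms by (simp add: crossing_edges_def X_def Y_def c_def)
  have c_fin: "finite {y \<in> Y. {x, y} \<in> edges g}" if "x \<in> X" for x
  proof -
    have "c x = (\<Sum>\<^sub>\<infinity>x\<in>{x}. c x)"
      by simp
    also have "\<dots> \<le> (\<Sum>\<^sub>\<infinity>x\<in>X. c x)"
      using that by (intro infsum_mono_neutral nonneg_summable_on_complete) auto
    finally have "finite {y \<in> Y. of_bool ({x, y} \<in> edges g) \<ge> (1 :: ennreal)}"
      using fin unfolding c_def by (intro finite_if_infsum_ennreal_finite) simp
    also have "{y \<in> Y. of_bool ({x, y} \<in> edges g) \<ge> (1 :: ennreal)} = {y \<in> Y. {x, y} \<in> edges g}"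
      by (auto simp: of_bool_def)
    finally show ?thesis .
  qed
  have "c x \<ge> 1" if "y \<in> Y" "{x, y} \<in> edges g" for x y
  proof -
    have "1 = (\<Sum>\<^sub>\<infinity>y\<in>{y}. of_bool ({x, y} \<in> edges g) :: ennreal)"
      using that by simp
    also have "\<dots> \<le> c x"
      unfolding c_def using that by (intro infsum_mono_neutral nonneg_summable_on_complete) auto
    finally show ?thesis .
  qed
  then have "cut_edges 0 g \<subseteq> (SIGMA x:{x \<in> X. c x \<ge> 1}. {y \<in> Y. {x, y} \<in> edges g})"
    using edge_endpoints_in_verts[OF g] by (auto simp: cut_edges_def oriented_edges_def X_def Y_def)
  moreover have "finite (SIGMA x:{x \<in> X. c x \<ge> 1}. {y \<in> Y. {x, y} \<in> edges g})"
    using finite_if_infsum_ennreal_finite[OF fin] c_fin by (intro finite_SigmaI) auto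
  ultimately show ?thesis
    by (rule finite_subset)
qed


section \<open>Translations of random geometric graphs\<close>

lemma space_graph_space [simp]: "space graph_space = graphs"
  by (simp add: graph_space_def space_measure_of_conv)

lemma sets_graph_space:
  "sets graph_space = sigma_sets graphs
     ({{g \<in> graphs. finite (verts g \<inter> A) \<and> card (verts g \<inter> A) = n} | A n. A \<in> sets borel} \<union>
      {{g \<in> graphs. finite (oriented_edges g \<inter> B) \<and> card (oriented_edges g \<inter> B) = n} | B n.
          B \<in> sets borel})"
  unfolding graph_space_def by (rule sets_measure_of) auto

lemma edge_count_sets:
  assumes "B \<in> sets borel"
  shows "{g \<in> graphs. finite (oriented_edges g \<inter> B) \<and> card (oriented_edges g \<inter> B) = n} \<in> sets graph_space"
  unfolding sets_graph_space using assms by (intro sigma_sets.Basic) blast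

text \<open>The generators prescribe an exact number of edges; a bound is a finite union of
  them.\<close>

lemma small_cut_sets [measurable]: "small_cut N t \<in> sets graph_space"
proof -
  have B: "{..t} \<times> {t<..} \<in> sets borel"
    by (intro borel_Times) auto
  have "small_cut N t = (\<Union>n\<le>N. {g \<in> graphs. finite (oriented_edges g \<inter> {..t} \<times> {t<..}) \<and>
      card (oriented_edges g \<inter> {..t} \<times> {t<..}) = n})"
    by (auto simp: small_cut_def cut_edges_def)
  also have "\<dots> \<in> sets graph_space"
    by (intro sets.finite_UN edge_count_sets[OF B]) auto
  finally show ?thesis .
qed

lemma translation_image_mem_iff:
  fixes v :: "'a::ab_group_add"
  shows "(\<lambda>x. x + v) ` e \<in> (\<lambda>e. (\<lambda>x. x + v) ` e) ` E \<longleftrightarrow> e \<in> E"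
  by (rule inj_image_mem_iff) (auto intro: injI simp: inj_image_eq_iff)

lemma oriented_edges_translate:
  "oriented_edges (translate v g) = (\<lambda>(x, y). (x + v, y + v)) ` oriented_edges g"
proof -
  have "(x, y) \<in> oriented_edges (translate v g) \<longleftrightarrow> (x - v, y - v) \<in> oriented_edges g" for x y
    using translation_image_mem_iff[of v "{x - v, y - v}" "edges g"]
    by (simp add: oriented_edges_def translate_def)
  moreover have "(x, y) \<in> (\<lambda>(x, y). (x + v, y + v)) ` oriented_edges g \<longleftrightarrow>
      (x - v, y - v) \<in> oriented_edges g" for x y
    by (auto simp: image_iff intro!: bexI[of _ "(x - v, y - v)"])
  ultimately show ?thesis
    by auto
qed

lemma translate_in_graphs:
  assumes "g \<in> graphs"
  shows "translate v g \<in> graphs"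
  using assms by (fastforce simp: graphs_def translate_def)

text \<open>Rewrites counts of a translated graph in a set as counts of the original graph in the
  preimage of that set.\<close>

lemma finite_card_image_Int:
  assumes "inj f"
  shows "finite (f ` A \<inter> B) \<longleftrightarrow> finite (A \<inter> f -` B)" and "card (f ` A \<inter> B) = card (A \<inter> f -` B)"
proof -
  have "f ` A \<inter> B = f ` (A \<inter> f -` B)"
    by auto
  then show "finite (f ` A \<inter> B) \<longleftrightarrow> finite (A \<inter> f -` B)" "card (f ` A \<inter> B) = card (A \<inter> f -` B)"
    using assms by (simp_all add: finite_image_iff card_image inj_on_subset)
qed

lemma inj_translate_pair: "inj (\<lambda>(x, y). (x + v, y + v :: 'a::group_add))"
  by (auto intro!: injI)

text \<open>It suffices to check generators, and the preimage of a counting event is the counting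
  event for the translated Borel set.\<close>

lemma translate_measurable [measurable]: "translate v \<in> measurable graph_space graph_space"
proof (rule measurable_sigma_sets[OF sets_graph_space])
  let ?t = "\<lambda>(x, y). (x + v, y + v)"
  fix A :: "'a graph set"
  assume "A \<in> {{g \<in> graphs. finite (verts g \<inter> A) \<and> card (verts g \<inter> A) = n} | A n. A \<in> sets borel} \<union>
      {{g \<in> graphs. finite (oriented_edges g \<inter> B) \<and> card (oriented_edges g \<inter> B) = n} | B n.
          B \<in> sets borel}"
  then consider
      (verts) D n where "D \<in> sets borel" "A = {g \<in> graphs. finite (verts g \<inter> D) \<and> card (verts g \<inter> D) = n}"
    | (edges) B n where "B \<in> sets borel"
        "A = {g \<in> graphs. finite (oriented_edges g \<inter> B) \<and> card (oriented_edges g \<inter> B) = n}"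
    by blast
  then show "translate v -` A \<inter> space graph_space \<in> sets graph_space"
  proof cases
    case verts
    have "(\<lambda>x. x + v) -` D \<in> sets borel"
      using measurable_sets_borel[OF _ verts(1), of "\<lambda>x. x + v"] by simp
    moreover have "translate v -` A \<inter> graphs = {g \<in> graphs. finite (verts g \<inter> (\<lambda>x. x + v) -` D) \<and>
        card (verts g \<inter> (\<lambda>x. x + v) -` D) = n}"
      using translate_in_graphs
      by (auto simp: verts(2) translate_def finite_card_image_Int inj_def)
    ultimately show ?thesis
      unfolding sets_graph_space space_graph_space by (intro sigma_sets.Basic) blast
  next
    case edges
    have "continuous_on UNIV ?t"
      by (auto simp: case_prod_unfold intro!: continuous_intros)
    then have "?t \<in> borel_measurable borel"
      by (rule borel_measurable_continuous_onI)
    then have "?t -` B \<in> sets borel"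
      using measurable_sets_borel[OF _ edges(1), of ?t] by simp
    moreover have "translate v -` A \<inter> graphs = {g \<in> graphs. finite (oriented_edges g \<inter> ?t -` B) \<and>
        card (oriented_edges g \<inter> ?t -` B) = n}"
      using translate_in_graphs
      by (auto simp: edges(2) oriented_edges_translate finite_card_image_Int[OF inj_translate_pair])
    ultimately show ?thesis
      by (simp add: edge_count_sets)
  qed
qed (auto simp: translate_in_graphs)

section \<open>Small cuts under a stationary and ergodic law\<close>

lemma translate_small_cut_iff:
  assumes "g \<in> graphs"
  shows "translate v g \<in> small_cut N t \<longleftrightarrow> g \<in> small_cut N (t - v)"
proof -
  have "(\<lambda>(x, y). (x + v, y + v)) -` ({..t} \<times> {t<..}) = {..t - v} \<times> {t - v<..}"
    by (auto simp: algebra_simps)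
  then show ?thesis
    using assms by (simp add: small_cut_def cut_edges_def translate_in_graphs oriented_edges_translate
        finite_card_image_Int[OF inj_translate_pair])
qed

text \<open>Shifting the graph by \<open>n\<close> carries its cut at 0 to the cut at
  \<open>n\<close>, and the shift preserves the law.\<close>

lemma law_small_cut_eq:
  assumes G: "G \<in> measurable M graph_space" and inv: "translation_invariant \<int> M G"
  shows "emeasure (law M G) (small_cut N (of_int n)) = emeasure (law M G) (small_cut N 0)"
proof -
  have "emeasure (law M G) (small_cut N (of_int n)) =
      emeasure (law M (\<lambda>w. translate (of_int n) (G w))) (small_cut N (of_int n))"
    using inv by (simp add: translation_invariant_def)
  also have "\<dots> = emeasure M ((\<lambda>w. translate (of_int n) (G w)) -` small_cut N (of_int n) \<inter> space M)"
    unfolding law_def by (intro emeasure_distr measurable_compose[OF G]) auto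
  also have "(\<lambda>w. translate (of_int n) (G w)) -` small_cut N (of_int n) \<inter> space M =
      G -` small_cut N 0 \<inter> space M"
  proof -
    have "translate (of_int n) (G w) \<in> small_cut N (of_int n) \<longleftrightarrow> G w \<in> small_cut N 0"
      if "w \<in> space M" for w
      using measurable_space[OF G that] by (simp add: translate_small_cut_iff)
    then show ?thesis by blast
  qed
  also have "emeasure M \<dots> = emeasure (law M G) (small_cut N 0)"
    unfolding law_def by (intro emeasure_distr[symmetric] G) auto
  finally show ?thesis .
qed

text \<open>The tail unions decrease, and the one from \<open>k\<close> on contains
  \<open>A k\<close>; continuity from above passes the bound to the limit.\<close>

lemma (in prob_space) limsup_pos:
  assumes [measurable]: "\<And>n::nat. A n \<in> events" and "\<And>n. prob (A n) \<ge> p"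
  shows "prob (\<Inter>k. \<Union>n\<in>{k..}. A n) \<ge> p"
proof (rule LIMSEQ_le_const)
  show "(\<lambda>k. prob (\<Union>n\<in>{k..}. A n)) \<longlonglongrightarrow> prob (\<Inter>k. \<Union>n\<in>{k..}. A n)"
  proof (rule finite_Lim_measure_decseq)
    show "decseq (\<lambda>k. \<Union>n\<in>{k..}. A n)"
      unfolding decseq_def by (intro allI impI UN_mono) auto
  qed auto
  have "p \<le> prob (\<Union>n\<in>{k..}. A n)" for k
    by (rule order.trans[OF assms(2)[of k]], rule finite_measure_mono) auto
  then show "\<exists>K. \<forall>k\<ge>K. p \<le> prob (\<Union>n\<in>{k..}. A n)"
    by blast
qed

text \<open>The sign \<open>s\<close> treats both ends of the line at once. The event
  \<open>A\<close> has probability at least that of a small cut at 0, hence not 0, and ergodicity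
  leaves only 1.\<close>

lemma AE_infinitely_many_small_cuts:
  fixes s :: int
  assumes M: "prob_space M" and G: "G \<in> measurable M graph_space"
    and inv: "translation_invariant \<int> M G" and erg: "translation_ergodic \<int> M G"
    and pos: "emeasure (law M G) (small_cut N 0) > 0" and s: "s = 1 \<or> s = -1"
  shows "AE w in M. \<forall>k::int. \<exists>n\<ge>k. G w \<in> small_cut N (of_int (s * n))"
proof -
  interpret L: prob_space "law M G"
    unfolding law_def using M G by (rule prob_space.prob_space_distr)
  have sets_law [simp]: "sets (law M G) = sets graph_space"
    by (simp add: law_def)
  define A where "A = {g \<in> graphs. \<forall>k::int. \<exists>n\<ge>k. g \<in> small_cut N (of_int (s * n))}"
  define p where "p = L.prob (small_cut N 0)"
  have "p > 0"
    using pos by (simp add: p_def L.emeasure_eq_measure)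
  \<comment> \<open>The integer form of \<open>A\<close> suits the shift argument; this countable
    form over the naturals gives measurability and fits \<open>limsup_pos\<close>.\<close>
  have eq: "A = (\<Inter>k::nat. \<Union>n\<in>{k..}. small_cut N (of_int (s * int n)))"
  proof (intro equalityI subsetI)
    fix g assume g: "g \<in> A"
    show "g \<in> (\<Inter>k::nat. \<Union>n\<in>{k..}. small_cut N (of_int (s * int n)))"
    proof safe
      fix k :: nat
      obtain n where "n \<ge> int k" "g \<in> small_cut N (of_int (s * n))"
        using g by (auto simp: A_def)
      then show "g \<in> (\<Union>n\<in>{k..}. small_cut N (of_int (s * int n)))"
        by (intro UN_I[of "nat n"]) auto
    qed
  next
    fix g assume g: "g \<in> (\<Inter>k::nat. \<Union>n\<in>{k..}. small_cut N (of_int (s * int n)))"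
    have "\<exists>n\<ge>k. g \<in> small_cut N (of_int (s * n))" for k
    proof -
      obtain n where "n \<ge> nat k" "g \<in> small_cut N (of_int (s * int n))"
        using g by blast
      then show ?thesis
        by (intro exI[of _ "int n"]) auto
    qed
    moreover from this have "g \<in> graphs"
      by (auto simp: small_cut_def)
    ultimately show "g \<in> A"
      by (simp add: A_def)
  qed
  have [measurable]: "A \<in> sets graph_space"
    unfolding eq by measurable
  have prob: "L.prob (small_cut N (of_int n)) = p" for n
    using law_small_cut_eq[OF G inv, of N n] by (simp add: p_def measure_def)
  then have "L.prob A \<ge> p"
    unfolding eq by (intro L.limsup_pos) (simp_all only: prob sets_law small_cut_sets)
  moreover have "translate v -` A \<inter> space graph_space = A" if v: "v \<in> \<int>" for v
  proof -
    obtain m where m: "v = of_int m"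
      using v by (rule Ints_cases)
    have "(\<forall>k. \<exists>n\<ge>k. g \<in> small_cut N (of_int (s * n) - v)) \<longleftrightarrow>
        (\<forall>k. \<exists>n\<ge>k. g \<in> small_cut N (of_int (s * n)))" for g
    proof -
      \<comment> \<open>As \<open>s * s = 1\<close>, translating by \<open>m\<close> reindexes
        \<open>n\<close> as \<open>n - s * m\<close>, which does not affect a property required for
        arbitrarily large \<open>n\<close>.\<close>
      have shift: "of_int (s * n) - v = of_int (s * (n - s * m))" for n
        using s by (auto simp: m algebra_simps)
      show ?thesis
        unfolding shift
        by (metis add_diff_cancel_right' diff_add_cancel add_le_cancel_right)
    qed
    then have "translate v g \<in> A \<longleftrightarrow> g \<in> A" if "g \<in> graphs" for g
      unfolding A_def mem_Collect_eq using that
      by (simp only: translate_small_cut_iff translate_in_graphs)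
    moreover have "A \<subseteq> graphs"
      unfolding A_def by blast
    ultimately show ?thesis
      unfolding space_graph_space by blast
  qed
  ultimately have "L.prob A = 1"
    using erg \<open>p > 0\<close> \<open>A \<in> sets graph_space\<close> unfolding translation_ergodic_def by fastforce
  then have "AE g in law M G. g \<in> A"
    by (subst (asm) L.prob_eq_1) auto
  then have "AE w in M. G w \<in> A"
    unfolding law_def by (rule AE_distrD[OF G])
  then show ?thesis
    by eventually_elim (simp add: A_def)
qed

text \<open>If all the events were null, so would be their countable union \<open>U\<close>, which
  contains every outcome with a finite crossing count.\<close>

lemma ex_small_cut_pos:
  assumes G: "G \<in> measurable M graph_space"
    and pos: "\<P>(w in M. crossing_edges (G w) < \<infinity>) > 0"
  obtains N where "emeasure (law M G) (small_cut N 0) > 0"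
proof (rule ccontr)
  assume "\<not> thesis"
  then have 0: "emeasure (law M G) (small_cut N 0) = 0" for N
    using that by (metis not_gr_zero)
  define U where "U = (\<Union>N. G -` small_cut N 0 \<inter> space M)"
  have "emeasure M (G -` small_cut N 0 \<inter> space M) = 0" for N
    using 0[of N] G by (simp add: law_def emeasure_distr)
  then have "emeasure M U = 0"
    unfolding U_def using measurable_sets[OF G small_cut_sets] by (intro emeasure_UN_eq_0) auto
  moreover have "{w \<in> space M. crossing_edges (G w) < \<infinity>} \<subseteq> U"
  proof
    fix w assume w: "w \<in> {w \<in> space M. crossing_edges (G w) < \<infinity>}"
    then have "G w \<in> graphs"
      using measurable_space[OF G, of w] by simp
    then have "G w \<in> small_cut (card (cut_edges 0 (G w))) 0"
      using w finite_cut_edges_if_crossing_edges_finite[of "G w"] by (simp add: small_cut_def)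
    then show "w \<in> U"
      unfolding U_def using w by blast
  qed
  \<comment> \<open>Monotonicity of \<open>emeasure\<close> asks for measurability of the larger
    set, so the crossing event is controlled through \<open>U\<close>.\<close>
  moreover have "U \<in> sets M"
    unfolding U_def using measurable_sets[OF G small_cut_sets] by (intro sets.countable_UN) auto
  ultimately have "emeasure M {w \<in> space M. crossing_edges (G w) < \<infinity>} = 0"
    using emeasure_mono[of _ U M] by fastforce
  then show False
    using pos by (simp add: measure_def)
qed

theorem theorem2p1:
  fixes M :: "'w measure" and G :: "'w \<Rightarrow> real graph"
  assumes "random_geometric_graph M G"
    and "locally_finite M G"
    and "translation_invariant \<int> M G"
    and "translation_ergodic \<int> M G"
    and "\<P>(w in M. crossing_edges (G w) < \<infinity>) > 0"
  shows "AE w in M. \<forall>C\<in>graph_components (G w). recurrent_component (G w) C"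
proof -
  have M: "prob_space M" and G: "G \<in> measurable M graph_space"
    using assms(1) by (auto simp: random_geometric_graph_def)
  obtain N where N: "emeasure (law M G) (small_cut N 0) > 0"
    using ex_small_cut_pos[OF G assms(5)] by blast
  note AE_cuts = AE_infinitely_many_small_cuts[OF M G assms(3,4) N]
  have "AE w in M. \<forall>k::int. \<exists>n\<ge>k. G w \<in> small_cut N (of_int n)"
    using AE_cuts[of 1] by simp
  moreover have "AE w in M. \<forall>k::int. \<exists>n\<ge>k. G w \<in> small_cut N (of_int (- n))"
    using AE_cuts[of "-1"] by simp
  moreover have "AE w in M. G w \<in> graphs"
    using measurable_space[OF G] by simp
  ultimately show ?thesis
    using assms(2) unfolding locally_finite_def
  proof eventually_elim
    case (elim w)
    then show ?case
      using recurrent_component_if_small_cuts[of "G w" N] by blast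
  qed
qed

end
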